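(* Let $q\ge 6$ be a prime power and let $\mathcal V$ be a ruled quintic surface in $\mathrm{PG}(6,q)$. Every line of $\mathrm{PG}(6,q)$ meets $\mathcal V$ in $0$, $1$, $2$ or $q+1$ points. Further, $\mathcal V$ contains exactly $q+1$ lines, namely its generators.
   Context: Construction: in $\mathrm{PG}(6,q)$ let $\alpha$ be a plane and $\Pi_3$ a $3$-space with $\alpha\cap\Pi_3=\emptyset$. Let $\mathcal C$ be a non-degenerate conic in $\alpha$ and $\mathcal N_3$ a twisted cubic in $\Pi_3$, parametrised as $\mathcal C=\{(1,\theta,\theta^2)\}$ and $\mathcal N_3=\{(1,\epsilon,\epsilon^2,\epsilon^3)\}$ ($\theta,\epsilon\in\mathbb F_q\cup\{\infty\}$), and let $\phi\in\mathrm{PGL}(2,q)$ act on parameters, giving a bijection $\mathcal C\to\mathcal N_3$. The ruled quintic surface $\mathcal V$ is the set of points on the $q+1$ lines (generators) joining each point of $\mathcal C$ to its image under $\phi$. *)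

theory Defs
  imports "HOL-Analysis.Cartesian_Space"
begin

(* PG(n-1,q) is modelled by the lattice of linear subspaces of F_q^n: the
   projective dimension is one less than the vector space dimension, so points
   are one-dimensional linear subspaces, and two projective subspaces are disjoint
   iff the corresponding linear subspaces meet only in 0. *)

definition proj_subspace :: "nat \<Rightarrow> ('a::field ^ 'n) set \<Rightarrow> bool" where
  "proj_subspace k W \<longleftrightarrow> vec.subspace W \<and> vec.dim W = k + 1"

abbreviation proj_point :: "('a::field ^ 'n) set \<Rightarrow> bool" where
  "proj_point \<equiv> proj_subspace 0"

abbreviation proj_line :: "('a::field ^ 'n) set \<Rightarrow> bool" where
  "proj_line \<equiv> proj_subspace 1"

definition points_on :: "('a::field ^ 'n) set \<Rightarrow> ('a ^ 'n) set set" where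
  "points_on W = {P. proj_point P \<and> P \<subseteq> W}"

definition coord_basis :: "('a::field ^ 'n) list \<Rightarrow> ('a ^ 'n) set \<Rightarrow> bool" where
  "coord_basis bs W \<longleftrightarrow>
     distinct bs \<and> vec.independent (set bs) \<and> vec.span (set bs) = W"

(* Parameters range over F_q together with infinity, represented by the option type
   with None as infinity.  With respect to a coordinate basis bs of length d + 1,
   the value at t is the point (1, t, ..., t^d), and the value at infinity is
   (0, ..., 0, 1).  Length 3 gives a non-degenerate conic of the plane spanned
   by bs, length 4 a twisted cubic of the 3-space spanned by bs. *)

fun rational_curve_point ::
  "('a::field ^ 'n) list \<Rightarrow> 'a option \<Rightarrow> ('a ^ 'n) set" where
  "rational_curve_point bs (Some t) = vec.span {\<Sum>i<length bs. t ^ i *s (bs ! i)}"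
| "rational_curve_point bs None = vec.span {last bs}"

fun moebius_map :: "'a::field \<Rightarrow> 'a \<Rightarrow> 'a \<Rightarrow> 'a \<Rightarrow> 'a option \<Rightarrow> 'a option" where
  "moebius_map a b c d (Some t) =
     (if c * t + d = 0 then None else Some ((a * t + b) / (c * t + d)))"
| "moebius_map a b c d None = (if c = 0 then None else Some (a / c))"

definition PGL2 :: "('a::field option \<Rightarrow> 'a option) set" where
  "PGL2 = {moebius_map a b c d | a b c d. a * d - b * c \<noteq> 0}"

definition join_line :: "('a::field ^ 'n) set \<Rightarrow> ('a ^ 'n) set \<Rightarrow> ('a ^ 'n) set" where
  "join_line P Q = vec.span (P \<union> Q)"

definition ruled_quintic_surface ::
  "('a::{field,finite} ^ 7) set set \<Rightarrow> ('a ^ 7) set set \<Rightarrow> bool" where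
  "ruled_quintic_surface V G \<longleftrightarrow>
     (\<exists>\<alpha> \<sigma> us ws \<phi>.
        proj_subspace 2 \<alpha> \<and> proj_subspace 3 \<sigma> \<and> \<alpha> \<inter> \<sigma> = {0} \<and>
        length us = 3 \<and> coord_basis us \<alpha> \<and>
        length ws = 4 \<and> coord_basis ws \<sigma> \<and>
        \<phi> \<in> PGL2 \<and>
        G = {join_line (rational_curve_point us \<theta>) (rational_curve_point ws (\<phi> \<theta>)) | \<theta>. True} \<and>
        V = (\<Union>L\<in>G. points_on L))"

end

theory Submission
  imports Defs
begin

text \<open>Any three distinct points of the conic are linearly independent, and so are any three
  distinct points of the twisted cubic. As \<open>\<alpha>\<close> and \<open>\<Pi>\<^sub>3\<close> are in direct sum, a linear relation
  between vectors on three distinct generators splits into a relation on the conic and a relation on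
  the cubic, so it is trivial. Hence three collinear points of the surface lie on one generator,
  and a line with at least three points of the surface is a generator.\<close>

section \<open>Representative vectors of the conic and the cubic; independence of three of
  them\<close>

definition curve_coord :: "nat \<Rightarrow> 'a::field option \<Rightarrow> nat \<Rightarrow> 'a" where
  "curve_coord n t i = (case t of None \<Rightarrow> if Suc i = n then 1 else 0 | Some s \<Rightarrow> s ^ i)"

text \<open>A fixed representative of the projective point, so that collinearity can be expressed by
  relations with scalar coefficients.\<close>

definition curve_vec :: "('a::field ^ 'n) list \<Rightarrow> 'a option \<Rightarrow> 'a ^ 'n" where
  "curve_vec bs t = (\<Sum>i<length bs. curve_coord (length bs) t i *s bs ! i)"

lemma rational_curve_point_eq_span:
  assumes "bs \<noteq> []"
  shows "rational_curve_point bs t = vec.span {curve_vec bs t}"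
proof (cases t)
  case None
  \<comment> \<open>At infinity only index \<open>length bs - 1\<close> has a nonzero coefficient,
    so the sum collapses to the last basis vector.\<close>
  have "curve_vec bs None = (\<Sum>i<length bs. if i = length bs - 1 then bs ! i else 0)"
    unfolding curve_vec_def by (rule sum.cong) (auto simp: curve_coord_def)
  also have "\<dots> = last bs"
    using assms by (simp add: last_conv_nth)
  finally show ?thesis using None by simp
next
  case (Some s)
  then show ?thesis by (simp add: curve_vec_def curve_coord_def)
qed

text \<open>For finite parameters, coordinates 0, 1, 2 form a Vandermonde system. If one parameter
  is infinity, its coordinates 0 and 1 vanish because \<open>n \<ge> 3\<close>, which leaves a 2 by
  2 Vandermonde system for the other two.\<close>

lemma curve_coord_independent:
  assumes "n \<ge> 3" "distinct [t1, t2, t3]"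
    and rel: "\<And>i. i < n \<Longrightarrow> a * curve_coord n t1 i + b * curve_coord n t2 i + c * curve_coord n t3 i = 0"
  shows "a = 0 \<and> b = 0 \<and> c = 0"
proof -
  \<comment> \<open>The 2 by 2 Vandermonde system: subtracting \<open>s\<close> times the first
    equation from the second eliminates \<open>x\<close>.\<close>
  have pair: "x = 0 \<and> y = 0" if "x + y = 0" "x * s + y * r = 0" "s \<noteq> r" for x y s r :: 'a
  proof -
    have "y * (r - s) = 0" using that by algebra
    with that show ?thesis by auto
  qed
  \<comment> \<open>The only coordinate in which the vector at infinity is nonzero; it yields the
    coefficient of that vector once the other two are known to vanish.\<close>
  have last: "a * curve_coord n t1 (n - 1) + b * curve_coord n t2 (n - 1)
      + c * curve_coord n t3 (n - 1) = 0"
    by (rule rel) (use assms(1) in auto)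
  note low = rel[of 0] rel[of 1] rel[of 2] last
  show ?thesis
  proof (cases t1)
    case None
    then obtain r s where rs: "t2 = Some r" "t3 = Some s" "r \<noteq> s"
      using assms(2) by (cases t2; cases t3) auto
    have "b = 0 \<and> c = 0"
      using low assms(1) by (intro pair[of _ _ r s]) (auto simp: None rs curve_coord_def)
    then show ?thesis using low assms(1) by (auto simp: None rs curve_coord_def)
  next
    case t1: (Some p)
    show ?thesis
    proof (cases t2)
      case None
      then obtain s where s: "t3 = Some s" "p \<noteq> s"
        using assms(2) t1 by (cases t3) auto
      have "a = 0 \<and> c = 0"
        using low assms(1) s by (intro pair[of _ _ p s]) (auto simp: None s t1 curve_coord_def)
      then show ?thesis using low assms(1) by (auto simp: None s t1 curve_coord_def)
    next
      case t2: (Some r)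
      show ?thesis
      proof (cases t3)
        case None
        have "a = 0 \<and> b = 0"
          using low assms by (intro pair[of _ _ p r]) (auto simp: None t2 t1 curve_coord_def)
        then show ?thesis using low assms(1) by (auto simp: None t1 t2 curve_coord_def)
      next
        case t3: (Some s)
        have ne: "p \<noteq> r" "p \<noteq> s" "r \<noteq> s" using assms(2) t1 t2 t3 by auto
        have e: "a + b + c = 0" "a * p + b * r + c * s = 0" "a * p^2 + b * r^2 + c * s^2 = 0"
          using rel[of 0] rel[of 1] rel[of 2] assms(1) by (auto simp: t1 t2 t3 curve_coord_def)
        \<comment> \<open>Combine the equations with the coefficients of the quadratic with roots
          \<open>r\<close> and \<open>s\<close>; this eliminates \<open>b\<close> and
          \<open>c\<close>.\<close>
        have "a * ((p - r) * (p - s)) = 0" using e by algebra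
        then have "a = 0" using ne by simp
        moreover have "b = 0 \<and> c = 0"
          using e \<open>a = 0\<close> ne by (intro pair[of _ _ r s]) auto
        ultimately show ?thesis by simp
      qed
    qed
  qed
qed

text \<open>Passes from independence of a set to coefficients indexed by position: distinctness
  makes \<open>(!) bs\<close> injective on the indices, so \<open>f\<close> can be read as a
  function \<open>g\<close> of the basis vectors.\<close>

lemma independent_list_combination_eq_0:
  fixes bs :: "('a::field ^ 'n) list"
  assumes "distinct bs" "vec.independent (set bs)"
    and "(\<Sum>i<length bs. f i *s bs ! i) = 0" "i < length bs"
  shows "f i = 0"
proof -
  define g where "g v = f (the_inv_into {..<length bs} ((!) bs) v)" for v
  have inj: "inj_on ((!) bs) {..<length bs}"
    using assms(1) by (simp add: inj_on_nth)
  have g: "g (bs ! j) = f j" if "j < length bs" for j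
    using that by (simp add: g_def the_inv_into_f_f[OF inj])
  have img: "set bs = (!) bs ` {..<length bs}"
    by (auto simp: set_conv_nth)
  have "(\<Sum>v\<in>set bs. g v *s v) = (\<Sum>i<length bs. g (bs ! i) *s bs ! i)"
    unfolding img by (subst sum.reindex[OF inj]) simp
  also have "\<dots> = 0"
    using assms(3) g by simp
  finally have "g (bs ! i) = 0"
    using assms(2,4) vec.independentD[of "set bs" "set bs" g "bs ! i"] by simp
  with g assms(4) show ?thesis by simp
qed

text \<open>Comparing coefficients in the basis \<open>bs\<close> turns the relation between vectors
  into the same relation in every coordinate.\<close>

lemma curve_vec_independent:
  assumes "distinct bs" "vec.independent (set bs)" "length bs \<ge> 3" "distinct [t1, t2, t3]"
    and "a *s curve_vec bs t1 + b *s curve_vec bs t2 + c *s curve_vec bs t3 = 0"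
  shows "a = 0 \<and> b = 0 \<and> c = 0"
proof (rule curve_coord_independent[OF assms(3,4)])
  fix i assume "i < length bs"
  let ?n = "length bs"
  have "(\<Sum>i<?n. (a * curve_coord ?n t1 i + b * curve_coord ?n t2 i + c * curve_coord ?n t3 i)
      *s bs ! i) = a *s curve_vec bs t1 + b *s curve_vec bs t2 + c *s curve_vec bs t3"
    by (simp add: curve_vec_def vec.scale_sum_right sum.distrib vec.scale_left_distrib)
  with independent_list_combination_eq_0[OF assms(1,2) _ \<open>i < ?n\<close>] assms(5)
  show "a * curve_coord ?n t1 i + b * curve_coord ?n t2 i + c * curve_coord ?n t3 i = 0"
    by simp
qed

text \<open>Over every field, infinity, 0 and 1 are three different parameters.\<close>

lemma ex_third_parameter: "\<exists>t :: 'a::field option. t \<noteq> t1 \<and> t \<noteq> t2"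
proof (rule ccontr)
  assume "\<not> ?thesis"
  then have "{None, Some 0, Some (1::'a)} \<subseteq> {t1, t2}" by blast
  then have "card {None, Some 0, Some (1::'a)} \<le> card {t1, t2}" by (intro card_mono) auto
  moreover have "card {t1, t2} \<le> 2" by (simp add: card_insert_if)
  ultimately show False by simp
qed

text \<open>A zero vector would give, together with two further parameters, a relation with
  coefficients 1, 0, 0.\<close>

lemma curve_vec_nonzero:
  assumes "distinct bs" "vec.independent (set bs)" "length bs \<ge> 3"
  shows "curve_vec bs t \<noteq> 0"
proof
  assume *: "curve_vec bs t = 0"
  obtain t2 where "t2 \<noteq> t" using ex_third_parameter by blast
  moreover obtain t3 where "t3 \<noteq> t" "t3 \<noteq> t2" using ex_third_parameter by blast
  ultimately show False
    using curve_vec_independent[OF assms, of t t2 t3 1 0 0] * by auto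
qed

section \<open>Injectivity of the action of PGL(2,q) on parameters\<close>

lemma inj_moebius_map:
  assumes "a * d - b * c \<noteq> 0"
  shows "inj (moebius_map a b c d)"
proof (rule injI)
  fix s t assume eq: "moebius_map a b c d s = moebius_map a b c d t"
  \<comment> \<open>Equal values at \<open>x\<close> and at infinity make the determinant vanish:
    either \<open>c = 0\<close> and then \<open>d = 0\<close>, or cross-multiplying with
    \<open>a / c\<close> gives \<open>a * d = b * c\<close>.\<close>
  have mixed: False if "moebius_map a b c d (Some x) = moebius_map a b c d None" for x
    using that assms by (auto simp: field_simps split: if_splits)
  show "s = t"
  proof (cases "s = None \<or> t = None")
    case True
    then show ?thesis using eq mixed by (metis not_Some_eq)
  next
    case False
    then obtain x y where xy: "s = Some x" "t = Some y" by auto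
    \<comment> \<open>Away from the pole this product is the difference of the two sides after
      cross-multiplication. At the pole, \<open>c * (x - y) = 0\<close> and
      \<open>d = - c * x\<close> make it vanish.\<close>
    have "(a * d - b * c) * (x - y) = 0"
    proof (cases "c * x + d = 0")
      case True
      then have "c * y + d = 0" using eq xy by (auto split: if_splits)
      with True show ?thesis by algebra
    next
      case False
      then have "c * y + d \<noteq> 0" using eq xy by (auto split: if_splits)
      with False have "(a * x + b) * (c * y + d) = (a * y + b) * (c * x + d)"
        using eq xy by (simp add: frac_eq_eq)
      then show ?thesis by algebra
    qed
    then show ?thesis using assms xy by simp
  qed
qed

section \<open>Points and lines as spans; the number of points on a line\<close>

lemma proj_point_iff: "proj_point P \<longleftrightarrow> (\<exists>v. v \<noteq> 0 \<and> P = vec.span {v})"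
proof
  assume P: "proj_point P"
  then have "vec.subspace P" "vec.dim P = 1" by (auto simp: proj_subspace_def)
  then obtain B where B: "B \<subseteq> P" "vec.independent B" "P \<subseteq> vec.span B" "card B = 1"
    using vec.basis_exists[of P] by metis
  then obtain v where v: "B = {v}" by (auto simp: card_1_singleton_iff)
  have "vec.span B \<subseteq> P"
    using B \<open>vec.subspace P\<close> by (simp add: vec.span_minimal)
  then have "P = vec.span {v}" using B(3) unfolding v by (rule subset_antisym[rotated])
  moreover have "v \<noteq> 0" using B(2) unfolding v by simp
  ultimately show "\<exists>v. v \<noteq> 0 \<and> P = vec.span {v}" by blast
next
  assume "\<exists>v. v \<noteq> 0 \<and> P = vec.span {v}"
  then obtain v where "v \<noteq> 0" "P = vec.span {v}" by blast
  moreover have "vec.independent {v}" using \<open>v \<noteq> 0\<close> by simp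
  ultimately show "proj_point P"
    by (simp add: proj_subspace_def vec.dim_eq_card_independent)
qed

lemma span_pair: "vec.span {x, y} = {a *s x + b *s y | a b. True}"
  for x y :: "'a::field ^ 'n"
proof (intro equalityI subsetI)
  fix z assume "z \<in> vec.span {x, y}"
  then obtain a where "z - a *s x \<in> vec.span {y}" by (auto simp: vec.span_breakdown_eq)
  then obtain b where "z - a *s x = b *s y" by (auto simp: vec.span_singleton)
  then have "z = a *s x + b *s y" by (simp add: diff_eq_eq add.commute)
  then show "z \<in> {a *s x + b *s y | a b. True}" by blast
next
  fix z assume "z \<in> {a *s x + b *s y | a b. True}"
  then show "z \<in> vec.span {x, y}"
    by (auto intro!: vec.span_add vec.span_scale intro: vec.span_base)
qed

text \<open>Phrased by coefficients because for \<open>x = y\<close> the set \<open>{x, y}\<close>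
  collapses to a singleton, whose independence says too little.\<close>

definition lin_indep2 :: "'a::field ^ 'n \<Rightarrow> 'a ^ 'n \<Rightarrow> bool" where
  "lin_indep2 x y \<longleftrightarrow> (\<forall>a b. a *s x + b *s y = 0 \<longrightarrow> a = 0 \<and> b = 0)"

lemma lin_indep2_iff: "lin_indep2 x y \<longleftrightarrow> x \<noteq> y \<and> vec.independent {x, y}"
proof
  assume *: "lin_indep2 x y"
  have "y \<noteq> 0" using *[unfolded lin_indep2_def, rule_format, of 0 1] by auto
  moreover have "x \<notin> vec.span {y}"
  proof
    assume "x \<in> vec.span {y}"
    then obtain k where "x = k *s y" by (auto simp: vec.span_singleton)
    then show False using *[unfolded lin_indep2_def, rule_format, of 1 "- k"] by simp
  qed
  moreover from this have "x \<noteq> y" by (auto simp: vec.span_base)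
  ultimately show "x \<noteq> y \<and> vec.independent {x, y}" by (simp add: vec.independent_insert)
next
  assume *: "x \<noteq> y \<and> vec.independent {x, y}"
  then have y: "y \<noteq> 0" and x: "x \<notin> vec.span {y}" by (auto simp: vec.independent_insert)
  show "lin_indep2 x y"
    unfolding lin_indep2_def
  proof (intro allI impI)
    fix a b assume eq: "a *s x + b *s y = 0"
    have "a = 0"
    proof (rule ccontr)
      assume "a \<noteq> 0"
      have "a *s x = (- b) *s y" using eq by (simp add: eq_neg_iff_add_eq_0)
      then have "inverse a *s (a *s x) = (inverse a * (- b)) *s y" by simp
      then have "x = (inverse a * (- b)) *s y" using \<open>a \<noteq> 0\<close> by simp
      then show False using x vec.span_base[of y "{y}"] vec.span_scale by (metis insertI1)
    qed
    with eq y show "a = 0 \<and> b = 0" by simp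
  qed
qed

lemma proj_line_span_pair: "lin_indep2 x y \<Longrightarrow> proj_line (vec.span {x, y})"
  by (simp add: proj_subspace_def lin_indep2_iff vec.dim_eq_card_independent)

lemma proj_line_obtain_basis:
  assumes "proj_line L"
  obtains x y where "lin_indep2 x y" "L = vec.span {x, y}"
proof -
  have L: "vec.subspace L" "vec.dim L = 2" using assms by (auto simp: proj_subspace_def)
  then obtain B where B: "B \<subseteq> L" "vec.independent B" "L \<subseteq> vec.span B" "card B = 2"
    using vec.basis_exists[of L] by metis
  then obtain x y where "B = {x, y}" "x \<noteq> y" by (auto simp: card_2_iff)
  moreover have "vec.span B \<subseteq> L"
    using B L by (simp add: vec.span_minimal)
  ultimately show thesis using B that[of x y] by (simp add: lin_indep2_iff subset_antisym)
qed

lemma proj_line_eqI: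
  assumes "proj_line L" "proj_line M" "L \<subseteq> M"
  shows "L = M"
  using assms vec.subspace_dim_equal[of L M] by (simp add: proj_subspace_def)

lemma span_singleton_eqI:
  fixes x y :: "'a::field ^ 'n"
  assumes "x = k *s y" "x \<noteq> 0"
  shows "vec.span {x} = vec.span {y}"
proof -
  have k: "k \<noteq> 0" using assms by auto
  have "y = inverse k *s x" using assms(1) k by simp
  then have "y \<in> vec.span {x}" by (auto simp: vec.span_singleton)
  moreover have "x \<in> vec.span {y}" using assms by (auto simp: vec.span_singleton)
  ultimately show ?thesis by (auto simp: vec.span_eq)
qed

text \<open>Two different points on a line thus supply a basis of it.\<close>

lemma lin_indep2_if_span_neq:
  fixes x y :: "'a::field ^ 'n"
  assumes "x \<noteq> 0" "y \<noteq> 0" "vec.span {x} \<noteq> vec.span {y}"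
  shows "lin_indep2 x y"
proof -
  have "x \<notin> vec.span {y}"
  proof
    assume "x \<in> vec.span {y}"
    then obtain k where "x = k *s y" by (auto simp: vec.span_singleton)
    with assms span_singleton_eqI[of x k y] show False by blast
  qed
  moreover from this have "x \<noteq> y" by (auto simp: vec.span_base)
  ultimately show ?thesis using assms by (simp add: lin_indep2_iff vec.independent_insert)
qed

text \<open>Scaling the coefficient of \<open>x\<close> to 1 wherever it is nonzero puts the points
  in bijection with \<open>'a option\<close>: infinity goes to \<open>y\<close>, and
  \<open>s\<close> to \<open>x + s *s y\<close>.\<close>

lemma card_points_on_proj_line:
  fixes L :: "('a::{field,finite} ^ 'n) set"
  assumes "proj_line L"
  shows "card (points_on L) = CARD('a) + 1"
proof -
  obtain x y where ind: "lin_indep2 x y" and L: "L = vec.span {x, y}"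
    using proj_line_obtain_basis[OF assms] .
  define f where "f t = (case t of None \<Rightarrow> y | Some s \<Rightarrow> x + s *s y)" for t
  have ab: "a = 0 \<and> b = 0" if "a *s x + b *s y = 0" for a b
    using ind that by (auto simp: lin_indep2_def)
  have f0: "f t \<noteq> 0" for t
    using ab[of 0 1] ab[of 1] by (auto simp: f_def split: option.splits)
  have fL: "f t \<in> L" for t
    by (auto simp: f_def L vec.span_base vec.span_add vec.span_scale split: option.splits)
  have "s = t" if eq: "vec.span {f s} = vec.span {f t}" for s t
  proof -
    have "f s \<in> vec.span {f t}" using eq by (metis insertI1 vec.span_base)
    then obtain k where k: "f s = k *s f t" by (auto simp: vec.span_singleton)
    \<comment> \<open>Compare coefficients of \<open>x\<close> and \<open>y\<close>. The mixed cases
      are absurd (\<open>k = 0\<close> with \<open>k * r = 1\<close>, or \<open>1 = 0\<close>); for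
      finite parameters \<open>k = 1\<close>, whence \<open>p = r\<close>.\<close>
    show ?thesis
    proof (cases s; cases t)
      fix r assume "s = None" "t = Some r"
      then have "k *s x + (k * r - 1) *s y = 0"
        using k by (simp add: f_def vec.scale_right_distrib vec.scale_left_diff_distrib add_diff_eq)
      from ab[OF this] show ?thesis by auto
    next
      fix r assume "s = Some r" "t = None"
      then have "1 *s x + (r - k) *s y = 0"
        using k by (simp add: f_def vec.scale_left_diff_distrib algebra_simps)
      from ab[OF this] show ?thesis by auto
    next
      fix p r assume st: "s = Some p" "t = Some r"
      then have "(1 - k) *s x + (p - k * r) *s y = 0"
        using k by (simp add: f_def vec.scale_left_diff_distrib vec.scale_right_distrib algebra_simps)
      from ab[OF this] show ?thesis using st by auto
    qed simp
  qed
  then have inj: "inj (\<lambda>t. vec.span {f t})" by (auto intro: injI)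
  have "points_on L = range (\<lambda>t. vec.span {f t})"
  proof
    show "range (\<lambda>t. vec.span {f t}) \<subseteq> points_on L"
    proof safe
      fix t
      have "vec.span {f t} \<subseteq> L"
        using fL L by (intro vec.span_minimal) auto
      then show "vec.span {f t} \<in> points_on L"
        using f0 by (auto simp only: points_on_def proj_point_iff)
    qed
    show "points_on L \<subseteq> range (\<lambda>t. vec.span {f t})"
    proof
      fix P assume "P \<in> points_on L"
      then obtain v where v: "v \<noteq> 0" "P = vec.span {v}" "v \<in> L"
        by (auto simp: points_on_def proj_point_iff vec.span_base subset_iff)
      then obtain a b where vab: "v = a *s x + b *s y" by (auto simp: L span_pair)
      have "\<exists>k t. v = k *s f t"
      proof (cases "a = 0")
        case True
        then have "v = b *s f None" using vab by (simp add: f_def)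
        then show ?thesis by blast
      next
        case False
        then have "v = a *s f (Some (b / a))" using vab by (simp add: f_def vec.scale_right_distrib)
        then show ?thesis by blast
      qed
      then show "P \<in> range (\<lambda>t. vec.span {f t})"
        using v span_singleton_eqI by blast
    qed
  qed
  then show ?thesis using inj by (simp add: card_image)
qed

section \<open>Generators of the surface and its intersections with lines\<close>

theorem theorem2p4:
  fixes V G :: "('a::{field,finite} ^ 7) set set"
  assumes "CARD('a) \<ge> 6"
    and "ruled_quintic_surface V G"
  shows "(\<forall>L. proj_line L \<longrightarrow> card (points_on L \<inter> V) \<in> {0, 1, 2, CARD('a) + 1}) \<and>
         card {L. proj_line L \<and> points_on L \<subseteq> V} = CARD('a) + 1 \<and>
         {L. proj_line L \<and> points_on L \<subseteq> V} = G"
proof -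
  obtain \<alpha> \<sigma> us ws \<phi> where
    sub: "proj_subspace 2 \<alpha>" "proj_subspace 3 \<sigma>" "\<alpha> \<inter> \<sigma> = {0}"
    and us: "length us = 3" "coord_basis us \<alpha>"
    and ws: "length ws = 4" "coord_basis ws \<sigma>"
    and \<phi>: "\<phi> \<in> PGL2"
    and G: "G = {join_line (rational_curve_point us \<theta>) (rational_curve_point ws (\<phi> \<theta>)) | \<theta>. True}"
    and V: "V = (\<Union>L\<in>G. points_on L)"
    using assms(2) unfolding ruled_quintic_surface_def by (elim exE conjE) blast
  have inj_\<phi>: "inj \<phi>" using \<phi> inj_moebius_map by (auto simp: PGL2_def)
  \<comment> \<open>Both representatives are indexed by the conic parameter: \<open>w\<close>
    absorbs \<phi>, so a generator depends on one parameter.\<close>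
  define u where "u = curve_vec us"
  define w where "w = (\<lambda>t. curve_vec ws (\<phi> t))"
  define gen where "gen t = vec.span {u t, w t}" for t
  have ssp: "vec.subspace \<alpha>" "vec.subspace \<sigma>" using sub by (auto simp: proj_subspace_def)
  have us': "distinct us" "vec.independent (set us)" "length us \<ge> 3"
    and ws': "distinct ws" "vec.independent (set ws)" "length ws \<ge> 3"
    using us ws by (auto simp: coord_basis_def)
  have u\<alpha>: "u t \<in> \<alpha>" for t
    using us unfolding u_def curve_vec_def coord_basis_def
    by (metis (no_types, lifting) lessThan_iff nth_mem vec.span_base vec.span_scale vec.span_sum)
  have w\<sigma>: "w t \<in> \<sigma>" for t
    using ws unfolding w_def curve_vec_def coord_basis_def
    by (metis (no_types, lifting) lessThan_iff nth_mem vec.span_base vec.span_scale vec.span_sum)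
  \<comment> \<open>The sum of \<alpha> and \<sigma> is direct, since \<open>x = - y\<close> lies in
    both.\<close>
  have split: "x = 0 \<and> y = 0" if "x \<in> \<alpha>" "y \<in> \<sigma>" "x + y = 0" for x y
  proof -
    have "x = - y" using that(3) by (simp add: eq_neg_iff_add_eq_0)
    then have "x \<in> \<sigma>" using that(2) ssp(2) by (simp add: vec.subspace_neg)
    then have "x = 0" using that(1) sub(3) by blast
    with that(3) show ?thesis by simp
  qed
  have "gen t = join_line (rational_curve_point us t) (rational_curve_point ws (\<phi> t))" for t
  proof -
    have "us \<noteq> []" "ws \<noteq> []" using us ws by auto
    moreover have "vec.span {x, y} = vec.span (vec.span {x} \<union> vec.span {y})" for x y :: "'a ^ 7"
      by (intro subset_antisym vec.span_minimal vec.subspace_span)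
        (auto intro: vec.span_base vec.span_mono[THEN subsetD, rotated])
    ultimately show ?thesis
      by (simp add: join_line_def rational_curve_point_eq_span gen_def u_def w_def)
  qed
  then have G: "G = range gen" using G by auto
  have gen_indep: "lin_indep2 (u t) (w t)" for t
    unfolding lin_indep2_def
  proof (intro allI impI)
    fix a b assume "a *s u t + b *s w t = 0"
    then have "a *s u t = 0 \<and> b *s w t = 0"
      by (intro split) (auto simp: u\<alpha> w\<sigma> ssp vec.subspace_scale)
    then show "a = 0 \<and> b = 0"
      using curve_vec_nonzero[OF us'] curve_vec_nonzero[OF ws'] by (auto simp: u_def w_def)
  qed
  have gen_line: "proj_line (gen t)" for t
    unfolding gen_def by (rule proj_line_span_pair[OF gen_indep])
  \<comment> \<open>Regroup the relation into its \<alpha>-part and its \<sigma>-part. Each involves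
    three distinct points of one curve; on the cubic they stay distinct because \<phi> is
    injective.\<close>
  have three: "x = 0 \<and> y = 0 \<and> z = 0"
    if dist: "distinct [r, s, t]" and mem: "x \<in> gen r" "y \<in> gen s" "z \<in> gen t"
      and sum0: "x + y + z = 0" for r s t x y z
  proof -
    obtain a a' where x: "x = a *s u r + a' *s w r" using mem by (auto simp: gen_def span_pair)
    obtain b b' where y: "y = b *s u s + b' *s w s" using mem by (auto simp: gen_def span_pair)
    obtain c c' where z: "z = c *s u t + c' *s w t" using mem by (auto simp: gen_def span_pair)
    have "(a *s u r + b *s u s + c *s u t) + (a' *s w r + b' *s w s + c' *s w t) = 0"
      using sum0 by (simp add: x y z algebra_simps)
    then have "a *s u r + b *s u s + c *s u t = 0 \<and> a' *s w r + b' *s w s + c' *s w t = 0"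
      by (intro split) (auto simp: u\<alpha> w\<sigma> ssp vec.subspace_scale vec.subspace_add)
    moreover have "distinct [\<phi> r, \<phi> s, \<phi> t]" using dist inj_\<phi> by (auto dest: injD)
    ultimately show ?thesis
      using curve_vec_independent[OF us' dist, of a b c]
        curve_vec_independent[OF ws', of "\<phi> r" "\<phi> s" "\<phi> t" a' b' c']
      by (simp add: x y z u_def w_def)
  qed
  \<comment> \<open>Generators are pairwise disjoint: add the zero vector of a third generator and
    apply \<open>three\<close>.\<close>
  have two: "x = 0" if "r \<noteq> s" "x \<in> gen r" "y \<in> gen s" "x + y = 0" for r s x y
  proof -
    obtain t where "t \<noteq> r" "t \<noteq> s" using ex_third_parameter by blast
    then show ?thesis
      using three[of r s t x y 0] that by (auto simp: gen_def vec.span_zero)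
  qed
  have gen_add: "x + y \<in> gen t" if "x \<in> gen t" "y \<in> gen t" for x y t
    using that by (simp add: gen_def vec.span_add)
  \<comment> \<open>If exactly two parameters agree, the sum of their vectors lies on the common
    generator, and \<open>two\<close> makes the remaining vector zero.\<close>
  have same_gen: "r = s \<and> s = t"
    if mem: "x \<in> gen r" "y \<in> gen s" "z \<in> gen t" and ne: "x \<noteq> 0" "y \<noteq> 0" "z \<noteq> 0"
      and sum0: "x + y + z = 0" for r s t x y z
  proof -
    have "\<not> distinct [r, s, t]" using three mem ne sum0 by blast
    moreover have False if "r = s" "s \<noteq> t"
      using two[of t s z "x + y"] that mem ne sum0 gen_add by (auto simp: add.commute)
    moreover have False if "r = t" "s \<noteq> t"
      using two[of s t y "x + z"] that mem ne sum0 gen_add by (auto simp: algebra_simps)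
    moreover have False if "s = t" "r \<noteq> t"
      using two[of r t x "y + z"] that mem ne sum0 gen_add by (auto simp: algebra_simps)
    ultimately show ?thesis by auto
  qed
  have inj_gen: "inj gen"
  proof (rule injI, rule ccontr)
    fix s t assume "gen s = gen t" "s \<noteq> t"
    moreover have "u s \<in> gen s" by (simp add: gen_def vec.span_base)
    ultimately have "u s = 0"
      using two[of s t "u s" "- u s"] by (simp add: gen_def vec.span_neg)
    then show False using curve_vec_nonzero[OF us'] by (simp add: u_def)
  qed
  have card_G: "card G = CARD('a) + 1"
    using inj_gen by (simp add: G card_image)
  \<comment> \<open>Write \<open>z = a *s x + b *s y\<close>. As the points differ, \<open>a\<close>
    and \<open>b\<close> are nonzero, so \<open>same_gen\<close> applies to \<open>a *s x\<close>,
    \<open>b *s y\<close>, \<open>- z\<close>. Then \<open>x\<close> and \<open>y\<close> span both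
    \<open>L\<close> and one generator.\<close>
  have in_G: "L \<in> G"
    if L: "proj_line L" and P: "{P1, P2, P3} \<subseteq> points_on L \<inter> V" "distinct [P1, P2, P3]"
    for L P1 P2 P3
  proof -
    have pt: "\<exists>v t. v \<noteq> 0 \<and> P = vec.span {v} \<and> v \<in> L \<and> v \<in> gen t"
      if "P \<in> points_on L \<inter> V" for P
    proof -
      from that obtain t where "proj_point P" "P \<subseteq> L" "P \<subseteq> gen t"
        unfolding V G points_on_def by blast
      moreover then obtain v where "v \<noteq> 0" "P = vec.span {v}" using proj_point_iff by blast
      moreover have "v \<in> vec.span {v}" by (simp add: vec.span_base)
      ultimately show ?thesis by blast
    qed
    have P': "P1 \<in> points_on L \<inter> V" "P2 \<in> points_on L \<inter> V" "P3 \<in> points_on L \<inter> V"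
      using P(1) by auto
    obtain x r where x: "x \<noteq> 0" "P1 = vec.span {x}" "x \<in> L" "x \<in> gen r"
      using pt[OF P'(1)] by blast
    obtain y s where y: "y \<noteq> 0" "P2 = vec.span {y}" "y \<in> L" "y \<in> gen s"
      using pt[OF P'(2)] by blast
    obtain z t where z: "z \<noteq> 0" "P3 = vec.span {z}" "z \<in> L" "z \<in> gen t"
      using pt[OF P'(3)] by blast
    have "lin_indep2 x y" using x y P by (intro lin_indep2_if_span_neq) auto
    then have line: "proj_line (vec.span {x, y})" by (rule proj_line_span_pair)
    have "vec.span {x, y} \<subseteq> L"
      using x y L by (intro vec.span_minimal) (auto simp: proj_subspace_def)
    then have Lxy: "vec.span {x, y} = L" using line L by (intro proj_line_eqI)
    then obtain a b where zab: "z = a *s x + b *s y" using z by (auto simp: span_pair)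
    have "a \<noteq> 0"
    proof
      assume "a = 0"
      then have "P3 = P2" using zab z y span_singleton_eqI[of z b y] by simp
      then show False using P by simp
    qed
    have "b \<noteq> 0"
    proof
      assume "b = 0"
      then have "P3 = P1" using zab z x span_singleton_eqI[of z a x] by simp
      then show False using P by simp
    qed
    have "r = s \<and> s = t"
    proof (rule same_gen)
      show "a *s x \<in> gen r" "b *s y \<in> gen s" "- z \<in> gen t"
        using x y z by (auto simp: gen_def vec.span_scale vec.span_neg)
      show "a *s x \<noteq> 0" "b *s y \<noteq> 0" "- z \<noteq> 0"
        using x(1) y(1) z(1) \<open>a \<noteq> 0\<close> \<open>b \<noteq> 0\<close> by simp_all
      show "a *s x + b *s y + - z = 0" by (simp add: zab)
    qed
    then have "{x, y} \<subseteq> gen r" using x y by auto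
    then have "vec.span {x, y} \<subseteq> gen r"
      unfolding gen_def by (intro vec.span_minimal) auto
    then have "L = gen r" using Lxy L gen_line by (intro proj_line_eqI) auto
    then show ?thesis by (simp add: G)
  qed
  have in_G_card: "L \<in> G" if L: "proj_line L" and c: "card (points_on L \<inter> V) \<ge> 3" for L
  proof -
    obtain T where T: "T \<subseteq> points_on L \<inter> V" "card T = 3"
      using obtain_subset_with_card_n[OF c] by metis
    then obtain P1 P2 P3 where "T = {P1, P2, P3}" "distinct [P1, P2, P3]"
      by (auto simp: card_3_iff)
    with T(1) show ?thesis using in_G[OF L, of P1 P2 P3] by blast
  qed
  have G_V: "proj_line L \<and> points_on L \<subseteq> V" if "L \<in> G" for L
    using that gen_line by (auto simp: G V)
  \<comment> \<open>All \<open>q + 1\<close> points of a line inside the surface count, and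
    \<open>q \<ge> 6\<close> makes these at least three, so \<open>in_G_card\<close>
    applies.\<close>
  have lines: "{L. proj_line L \<and> points_on L \<subseteq> V} = G"
  proof (intro equalityI subsetI CollectI G_V)
    fix L assume "L \<in> {L. proj_line L \<and> points_on L \<subseteq> V}"
    then have L: "proj_line L" "points_on L \<inter> V = points_on L" by auto
    then show "L \<in> G"
      using in_G_card[of L] card_points_on_proj_line[of L] assms(1) by simp
  qed
  \<comment> \<open>A generator contributes all its \<open>q + 1\<close> points; any other line has
    fewer than three points on the surface.\<close>
  have "card (points_on L \<inter> V) \<in> {0, 1, 2, CARD('a) + 1}" if L: "proj_line L" for L
  proof (cases "L \<in> G")
    case True
    then have "points_on L \<inter> V = points_on L" using G_V by auto
    then show ?thesis using card_points_on_proj_line[OF L] by simp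
  next
    case False
    then have "card (points_on L \<inter> V) < 3" using in_G_card[OF L] by force
    then have "card (points_on L \<inter> V) \<in> {0, 1, 2}"
      unfolding insert_iff empty_iff by linarith
    then show ?thesis by blast
  qed
  then show ?thesis unfolding lines using card_G by blast
qed

end
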